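(* Fix the ambient six-functor formalism and a closed immersion $i:Z\hookrightarrow X$ with open complement $j:U\hookrightarrow X$ satisfying the recollement axioms. Let $\Lambda_Z$ be any assignment which, for every $A\in\mathcal C(X)$ and every class $c\in H^d(X;A)$ with $j^*c=0$, produces an element $\Lambda_Z(c)\in\mathrm{Hom}_{\mathcal C(Z)}(\mathbf 1_Z,i^!A[d])$, and suppose: (a) (triangle compatibility) if $\widetilde\Lambda_Z(c):\mathbf 1_X\to i_*i^!A[d]$ denotes the adjoint of $\Lambda_Z(c)$, then the composite $\mathbf 1_X\xrightarrow{\widetilde\Lambda_Z(c)}i_*i^!A[d]\xrightarrow{\epsilon_{A[d]}}A[d]$ equals $c$, where $\epsilon$ is the counit of $i_*\dashv i^!$; (b) (functoriality) $\Lambda$ satisfies the base-change, proper-pushforward and $\boxtimes$-compatibilities described in the context; (c) (excision) $\Lambda$ is local near $Z$, in the sense described in the context. Then for every such class $c$ one has $\Lambda_Z(c)\in\mathrm{Loc}_Z^{\mathrm{tor}}(c)$. Moreover, if $\mathrm{Loc}_Z^{\mathrm{tor}}(c)$ is a singleton, then $\Lambda_Z(c)=\mathrm{Loc}_Z(c)$.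
   Context: Setting: to each space $X$ is attached a stable triangulated category $\mathcal C(X)$ with a symmetric monoidal structure $(\otimes,\mathbf 1_X)$. Each morphism $f:X\to Y$ has exact functors $f^*\dashv f_*$, with $f^*$ symmetric monoidal, so $f^*\mathbf 1_Y\simeq\mathbf 1_X$. Recollement axioms for a closed immersion $i:Z\hookrightarrow X$ with open complement $j:U=X\setminus Z\hookrightarrow X$: adjunctions $i^*\dashv i_*\dashv i^!$ and $j_!\dashv j^*\dashv j_*$; $i_*$ and $j_!$ fully faithful; $j^*i_*=0$ and $i^*j_!=0$; functorial distinguished triangles $j_!j^*M\to M\to i_*i^*M\xrightarrow{+1}$ and $i_*i^!M\to M\to j_*j^*M\xrightarrow{+1}$ (maps given by adjunction units and counits). Definitions: $H^d(X;A)=\mathrm{Hom}_{\mathcal C(X)}(\mathbf 1_X,A[d])$; $H_Z^d(X;A)=\mathrm{Hom}_{\mathcal C(X)}(\mathbf 1_X,i_*i^!A[d])$; $\mathrm{forg}:H_Z^d(X;A)\to H^d(X;A)$ is induced by $\epsilon_A:i_*i^!A\to A$. For $c$ with $j^*c=0$, $\mathrm{Lift}_Z^d(c)=\{\widetilde c\in H_Z^d(X;A)\mid\mathrm{forg}(\widetilde c)=c\}$, and $\mathrm{Loc}_Z^{\mathrm{tor}}(c)\subset\mathrm{Hom}_{\mathcal C(Z)}(\mathbf 1_Z,i^!A[d])$ is its image under the adjunction isomorphism $H_Z^d(X;A)\cong\mathrm{Hom}_{\mathcal C(Z)}(\mathbf 1_Z,i^!A[d])$; "adjoint" refers to this isomorphism.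 If $\mathrm{Loc}_Z^{\mathrm{tor}}(c)$ is a singleton, its element is $\mathrm{Loc}_Z(c)$. Compatibilities in (b) and (c), required of the assignments $\Lambda$ for all closed immersions involved: - Base change: for a Cartesian square $i\circ g_Z=g\circ i'$ with $g:X'\to X$, $i':Z'\hookrightarrow X'$, and Beck–Chevalley isomorphisms $g^*i_*\simeq i'_*g_Z^*$, $g_Z^*i^!\simeq i'^!g^*$, one has $\Lambda_{Z'}(g^*c)=g_Z^*\Lambda_Z(c)$. - Proper pushforward: for $p:X\to Y$ proper, $k:W\hookrightarrow Y$ closed, $p_Z:Z\to W$ with the square $p\circ i=k\circ p_Z$ Cartesian, the corresponding Beck–Chevalley isomorphisms, coefficients $p^*A$ with $A\in\mathcal C(Y)$, and a natural transformation $\epsilon:p_*p^*\to\mathrm{id}$ used for pushforward, one has $\Lambda_W(p_*c)=(p_Z)_*\Lambda_Z(c)$. Here $p_*c$ is $\mathbf 1_Y\to p_*\mathbf 1_X\xrightarrow{p_*(c)}p_*p^*A[d]\xrightarrow{\epsilon}A[d]$, and $(p_Z)_*\lambda$ is $\mathbf 1_W\to(p_Z)_*\mathbf 1_Z\to(p_Z)_*i^!p^*A[d]\simeq k^!p_*p^*A[d]\to k^!A[d]$. - External products: for a space $Y$, $B\in\mathcal C(Y)$, $\beta\in H^e(Y;B)$, and $\boxtimes$ compatible with closed pushforward and extraordinary pullback for $Z\times Y\hookrightarrow X\times Y$, one has $\Lambda_{Z\times Y}(c\boxtimes\beta)=\Lambda_Z(c)\boxtimes\beta$. - Excision: for an open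 neighbourhood $v:V\hookrightarrow X$ of $Z$ with $i_V:Z\hookrightarrow V$, under $i_V^!v^*A\simeq i^!A$ one has $\Lambda_Z^X(c)=\Lambda_Z^V(v^*c)$. *)

theory Defs
  imports "HOL-Analysis.Abstract_Topology" "HOL-Algebra.Group"
begin

section \<open>Categories, functors, natural transformations\<close>

record ('o, 'a) cat =
  Obj :: "'o set"
  Arr :: "'a set"
  Src :: "'a \<Rightarrow> 'o"
  Tgt :: "'a \<Rightarrow> 'o"
  Ident :: "'o \<Rightarrow> 'a"
  Comp :: "'a \<Rightarrow> 'a \<Rightarrow> 'a"  (infixr "\<cdot>\<index>" 70)

definition Hom :: "('o, 'a, 'e) cat_scheme \<Rightarrow> 'o \<Rightarrow> 'o \<Rightarrow> 'a set" where
  "Hom C A B = {f \<in> Arr C. Src C f = A \<and> Tgt C f = B}"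

locale category =
  fixes C :: "('o, 'a, 'e) cat_scheme" (structure)
  assumes Src_Obj: "f \<in> Arr C \<Longrightarrow> Src C f \<in> Obj C"
    and Tgt_Obj: "f \<in> Arr C \<Longrightarrow> Tgt C f \<in> Obj C"
    and Ident_Hom: "A \<in> Obj C \<Longrightarrow> Ident C A \<in> Hom C A A"
    and Comp_Hom: "\<lbrakk>f \<in> Hom C A B; g \<in> Hom C B E\<rbrakk> \<Longrightarrow> g \<cdot> f \<in> Hom C A E"
    and Comp_assoc: "\<lbrakk>f \<in> Hom C A B; g \<in> Hom C B E; h \<in> Hom C E K\<rbrakk> \<Longrightarrow> (h \<cdot> g) \<cdot> f = h \<cdot> (g \<cdot> f)"
    and Comp_Ident: "f \<in> Hom C A B \<Longrightarrow> f \<cdot> Ident C A = f"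
    and Ident_Comp: "f \<in> Hom C A B \<Longrightarrow> Ident C B \<cdot> f = f"

definition inverse_arrows :: "('o, 'a, 'e) cat_scheme \<Rightarrow> 'a \<Rightarrow> 'a \<Rightarrow> bool" where
  "inverse_arrows C f g \<longleftrightarrow> f \<in> Arr C \<and> g \<in> Hom C (Tgt C f) (Src C f) \<and>
     g \<cdot>\<^bsub>C\<^esub> f = Ident C (Src C f) \<and> f \<cdot>\<^bsub>C\<^esub> g = Ident C (Tgt C f)"

definition iso_arr :: "('o, 'a, 'e) cat_scheme \<Rightarrow> 'a \<Rightarrow> bool" where
  "iso_arr C f \<longleftrightarrow> (\<exists>g. inverse_arrows C f g)"

definition invar :: "('o, 'a, 'e) cat_scheme \<Rightarrow> 'a \<Rightarrow> 'a" where
  "invar C f = (THE g. inverse_arrows C f g)"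

definition cartesian_square ::
  "('o, 'a, 'e) cat_scheme \<Rightarrow> 'a \<Rightarrow> 'a \<Rightarrow> 'a \<Rightarrow> 'a \<Rightarrow> bool" where
  "cartesian_square C a b c d \<longleftrightarrow>
     {a, b, c, d} \<subseteq> Arr C \<and> Src C b = Src C d \<and> Tgt C b = Src C a \<and> Tgt C d = Src C c \<and>
     Tgt C a = Tgt C c \<and> a \<cdot>\<^bsub>C\<^esub> b = c \<cdot>\<^bsub>C\<^esub> d \<and>
     (\<forall>T. \<forall>x \<in> Hom C T (Src C a). \<forall>y \<in> Hom C T (Src C c). a \<cdot>\<^bsub>C\<^esub> x = c \<cdot>\<^bsub>C\<^esub> y \<longrightarrow>
        (\<exists>!u. u \<in> Hom C T (Src C b) \<and> b \<cdot>\<^bsub>C\<^esub> u = x \<and> d \<cdot>\<^bsub>C\<^esub> u = y))"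

definition product_cone :: "('o, 'a, 'e) cat_scheme \<Rightarrow> 'a \<Rightarrow> 'a \<Rightarrow> 'o \<Rightarrow> 'o \<Rightarrow> bool" where
  "product_cone C a b X Y \<longleftrightarrow> a \<in> Arr C \<and> Tgt C a = X \<and> b \<in> Hom C (Src C a) Y \<and>
     (\<forall>T. \<forall>x \<in> Hom C T X. \<forall>y \<in> Hom C T Y.
        \<exists>!u. u \<in> Hom C T (Src C a) \<and> a \<cdot>\<^bsub>C\<^esub> u = x \<and> b \<cdot>\<^bsub>C\<^esub> u = y)"

record ('o, 'a, 'p, 'b) fctr =
  fO :: "'o \<Rightarrow> 'p"
  fA :: "'a \<Rightarrow> 'b"

definition id_fctr :: "('o, 'a, 'o, 'a) fctr" where
  "id_fctr = \<lparr>fO = id, fA = id\<rparr>"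

definition comp_fctr ::
  "('p, 'b, 'q, 'c, 'e) fctr_scheme \<Rightarrow> ('o, 'a, 'p, 'b, 'h) fctr_scheme \<Rightarrow> ('o, 'a, 'q, 'c) fctr"
  where "comp_fctr G F = \<lparr>fO = fO G \<circ> fO F, fA = fA G \<circ> fA F\<rparr>"

definition is_functor ::
  "('o, 'a, 'e) cat_scheme \<Rightarrow> ('p, 'b, 'h) cat_scheme \<Rightarrow> ('o, 'a, 'p, 'b, 'k) fctr_scheme \<Rightarrow> bool"
  where "is_functor C D F \<longleftrightarrow>
     (\<forall>A \<in> Obj C. fO F A \<in> Obj D) \<and>
     (\<forall>f \<in> Arr C. fA F f \<in> Hom D (fO F (Src C f)) (fO F (Tgt C f))) \<and>
     (\<forall>A \<in> Obj C. fA F (Ident C A) = Ident D (fO F A)) \<and>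
     (\<forall>f \<in> Arr C. \<forall>g \<in> Arr C. Tgt C f = Src C g \<longrightarrow> fA F (g \<cdot>\<^bsub>C\<^esub> f) = fA F g \<cdot>\<^bsub>D\<^esub> fA F f)"

definition nat_trans ::
  "('o, 'a, 'e) cat_scheme \<Rightarrow> ('p, 'b, 'h) cat_scheme \<Rightarrow> ('o, 'a, 'p, 'b, 'k) fctr_scheme \<Rightarrow>
   ('o, 'a, 'p, 'b, 'l) fctr_scheme \<Rightarrow> ('o \<Rightarrow> 'b) \<Rightarrow> bool"
  where "nat_trans C D F G \<tau> \<longleftrightarrow>
     (\<forall>A \<in> Obj C. \<tau> A \<in> Hom D (fO F A) (fO G A)) \<and>
     (\<forall>f \<in> Arr C. \<tau> (Tgt C f) \<cdot>\<^bsub>D\<^esub> fA F f = fA G f \<cdot>\<^bsub>D\<^esub> \<tau> (Src C f))"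

definition nat_iso ::
  "('o, 'a, 'e) cat_scheme \<Rightarrow> ('p, 'b, 'h) cat_scheme \<Rightarrow> ('o, 'a, 'p, 'b, 'k) fctr_scheme \<Rightarrow>
   ('o, 'a, 'p, 'b, 'l) fctr_scheme \<Rightarrow> ('o \<Rightarrow> 'b) \<Rightarrow> bool"
  where "nat_iso C D F G \<tau> \<longleftrightarrow> nat_trans C D F G \<tau> \<and> (\<forall>A \<in> Obj C. iso_arr D (\<tau> A))"

text \<open>\<open>adjunction C D L R \<eta> \<epsilon>\<close>: \<open>L : C \<rightarrow> D\<close> is left adjoint to \<open>R : D \<rightarrow> C\<close>.\<close>

definition adjunction ::
  "('o, 'a, 'e) cat_scheme \<Rightarrow> ('p, 'b, 'h) cat_scheme \<Rightarrow> ('o, 'a, 'p, 'b, 'k) fctr_scheme \<Rightarrow>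
   ('p, 'b, 'o, 'a, 'l) fctr_scheme \<Rightarrow> ('o \<Rightarrow> 'a) \<Rightarrow> ('p \<Rightarrow> 'b) \<Rightarrow> bool"
  where "adjunction C D L R \<eta> \<epsilon> \<longleftrightarrow>
     nat_trans C C id_fctr (comp_fctr R L) \<eta> \<and> nat_trans D D (comp_fctr L R) id_fctr \<epsilon> \<and>
     (\<forall>A \<in> Obj C. \<epsilon> (fO L A) \<cdot>\<^bsub>D\<^esub> fA L (\<eta> A) = Ident D (fO L A)) \<and>
     (\<forall>B \<in> Obj D. fA R (\<epsilon> B) \<cdot>\<^bsub>C\<^esub> \<eta> (fO R B) = Ident C (fO R B))"

definition fully_faithful ::
  "('o, 'a, 'e) cat_scheme \<Rightarrow> ('p, 'b, 'h) cat_scheme \<Rightarrow> ('o, 'a, 'p, 'b, 'k) fctr_scheme \<Rightarrow> bool"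
  where "fully_faithful C D F \<longleftrightarrow>
     (\<forall>A \<in> Obj C. \<forall>B \<in> Obj C. bij_betw (fA F) (Hom C A B) (Hom D (fO F A) (fO F B)))"


section \<open>Triangulated categories with a symmetric monoidal structure\<close>

text \<open>The translation functor is taken to be an automorphism, as in Verdier; its integral powers
  \<open>A \<mapsto> A[d]\<close> are recorded as a strict action of the group of integers. The morphisms
  \<open>A \<rightarrow> B \<rightarrow> E \<rightarrow> A[1]\<close> of a distinguished triangle form a member of \<open>Dist\<close>.\<close>

record ('o, 'a) tricat = "('o, 'a) cat" +
  addA :: "'a \<Rightarrow> 'a \<Rightarrow> 'a"
  zeroA :: "'o \<Rightarrow> 'o \<Rightarrow> 'a"
  shO :: "int \<Rightarrow> 'o \<Rightarrow> 'o"
  shA :: "int \<Rightarrow> 'a \<Rightarrow> 'a"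
  Dist :: "('a \<times> 'a \<times> 'a) set"

definition hom_grp :: "('o, 'a, 'e) tricat_scheme \<Rightarrow> 'o \<Rightarrow> 'o \<Rightarrow> 'a monoid" where
  "hom_grp C A B = \<lparr>carrier = Hom C A B, monoid.mult = addA C, one = zeroA C A B\<rparr>"

definition negA :: "('o, 'a, 'e) tricat_scheme \<Rightarrow> 'a \<Rightarrow> 'a" where
  "negA C f = inv\<^bsub>hom_grp C (Src C f) (Tgt C f)\<^esub> f"

definition is_zero :: "('o, 'a, 'e) tricat_scheme \<Rightarrow> 'o \<Rightarrow> bool" where
  "is_zero C A \<longleftrightarrow> A \<in> Obj C \<and> Ident C A = zeroA C A A"

definition shift_fctr :: "('o, 'a, 'e) tricat_scheme \<Rightarrow> int \<Rightarrow> ('o, 'a, 'o, 'a) fctr" where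
  "shift_fctr C d = \<lparr>fO = shO C d, fA = shA C d\<rparr>"

locale additive_category = category C
  for C :: "('o, 'a, 'e) tricat_scheme" (structure) +
  assumes hom_comm_group: "\<lbrakk>A \<in> Obj C; B \<in> Obj C\<rbrakk> \<Longrightarrow> comm_group (hom_grp C A B)"
    and Comp_add: "\<lbrakk>f \<in> Hom C A B; f' \<in> Hom C A B; g \<in> Hom C B E\<rbrakk>
      \<Longrightarrow> g \<cdot> addA C f f' = addA C (g \<cdot> f) (g \<cdot> f')"
    and add_Comp: "\<lbrakk>f \<in> Hom C A B; g \<in> Hom C B E; g' \<in> Hom C B E\<rbrakk>
      \<Longrightarrow> addA C g g' \<cdot> f = addA C (g \<cdot> f) (g' \<cdot> f)"
    and zero_object: "\<exists>K. is_zero C K"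
    and biproducts: "\<lbrakk>A \<in> Obj C; B \<in> Obj C\<rbrakk> \<Longrightarrow>
      \<exists>P. \<exists>p \<in> Hom C P A. \<exists>q \<in> Hom C P B. \<exists>s \<in> Hom C A P. \<exists>t \<in> Hom C B P.
        p \<cdot> s = Ident C A \<and> q \<cdot> t = Ident C B \<and> p \<cdot> t = zeroA C B A \<and> q \<cdot> s = zeroA C A B \<and>
        addA C (s \<cdot> p) (t \<cdot> q) = Ident C P"

locale triangulated_category = additive_category C
  for C :: "('o, 'a, 'e) tricat_scheme" (structure) +
  assumes shift_functor: "is_functor C C (shift_fctr C d)"
    and shift_add: "\<lbrakk>f \<in> Hom C A B; g \<in> Hom C A B\<rbrakk>
      \<Longrightarrow> shA C d (addA C f g) = addA C (shA C d f) (shA C d g)"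
    and shO_0: "A \<in> Obj C \<Longrightarrow> shO C 0 A = A"
    and shA_0: "f \<in> Arr C \<Longrightarrow> shA C 0 f = f"
    and shO_add: "A \<in> Obj C \<Longrightarrow> shO C (d + e) A = shO C d (shO C e A)"
    and shA_add: "f \<in> Arr C \<Longrightarrow> shA C (d + e) f = shA C d (shA C e f)"
    and Dist_type: "(f, g, h) \<in> Dist C \<Longrightarrow>
      \<exists>A B E. f \<in> Hom C A B \<and> g \<in> Hom C B E \<and> h \<in> Hom C E (shO C 1 A)"
    and TR1_iso: "\<lbrakk>(f, g, h) \<in> Dist C; f' \<in> Hom C A B; g' \<in> Hom C B E; h' \<in> Hom C E (shO C 1 A);
        u \<in> Hom C (Src C f) A; v \<in> Hom C (Src C g) B; w \<in> Hom C (Src C h) E;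
        iso_arr C u; iso_arr C v; iso_arr C w;
        f' \<cdot> u = v \<cdot> f; g' \<cdot> v = w \<cdot> g; h' \<cdot> w = shA C 1 u \<cdot> h\<rbrakk> \<Longrightarrow> (f', g', h') \<in> Dist C"
    and TR1_Ident: "\<lbrakk>A \<in> Obj C; is_zero C K\<rbrakk>
      \<Longrightarrow> (Ident C A, zeroA C A K, zeroA C K (shO C 1 A)) \<in> Dist C"
    and TR1_cone: "f \<in> Arr C \<Longrightarrow> \<exists>g h. (f, g, h) \<in> Dist C"
    and TR2: "\<lbrakk>f \<in> Hom C A B; g \<in> Hom C B E; h \<in> Hom C E (shO C 1 A)\<rbrakk>
      \<Longrightarrow> (f, g, h) \<in> Dist C \<longleftrightarrow> (g, h, negA C (shA C 1 f)) \<in> Dist C"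
    and TR3: "\<lbrakk>(f, g, h) \<in> Dist C; (f', g', h') \<in> Dist C;
        u \<in> Hom C (Src C f) (Src C f'); v \<in> Hom C (Src C g) (Src C g'); f' \<cdot> u = v \<cdot> f\<rbrakk>
      \<Longrightarrow> \<exists>w \<in> Hom C (Src C h) (Src C h'). g' \<cdot> v = w \<cdot> g \<and> h' \<cdot> w = shA C 1 u \<cdot> h"
    and TR4: "\<lbrakk>f \<in> Hom C A B; g \<in> Hom C B E;
        (f, f1, f2) \<in> Dist C; (g, g1, g2) \<in> Dist C; (g \<cdot> f, h1, h2) \<in> Dist C\<rbrakk>
      \<Longrightarrow> \<exists>u \<in> Hom C (Tgt C f1) (Tgt C h1). \<exists>w \<in> Hom C (Tgt C h1) (Tgt C g1).
           (u, w, shA C 1 f1 \<cdot> g2) \<in> Dist C \<and>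
           u \<cdot> f1 = h1 \<cdot> g \<and> h2 \<cdot> u = f2 \<and> w \<cdot> h1 = g1 \<and> g2 \<cdot> w = shA C 1 f \<cdot> h2"

text \<open>An exact functor carries natural isomorphisms \<open>fS d A : F (A[d]) \<rightarrow> (F A)[d]\<close>. The cocycle
  condition makes them determined by the case \<open>d = 1\<close>.\<close>

record ('o, 'a, 'p, 'b) xfctr = "('o, 'a, 'p, 'b) fctr" +
  fS :: "int \<Rightarrow> 'o \<Rightarrow> 'b"

definition exact_functor ::
  "('o, 'a, 'e) tricat_scheme \<Rightarrow> ('p, 'b, 'h) tricat_scheme \<Rightarrow>
   ('o, 'a, 'p, 'b, 'k) xfctr_scheme \<Rightarrow> bool"
  where "exact_functor C D F \<longleftrightarrow> is_functor C D F \<and>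
     (\<forall>A \<in> Obj C. \<forall>B \<in> Obj C. \<forall>f \<in> Hom C A B. \<forall>g \<in> Hom C A B.
        fA F (addA C f g) = addA D (fA F f) (fA F g)) \<and>
     (\<forall>d. nat_iso C D (comp_fctr F (shift_fctr C d)) (comp_fctr (shift_fctr D d) F) (fS F d)) \<and>
     (\<forall>A \<in> Obj C. fS F 0 A = Ident D (fO F A)) \<and>
     (\<forall>A \<in> Obj C. \<forall>d e. fS F (d + e) A = shA D d (fS F e A) \<cdot>\<^bsub>D\<^esub> fS F d (shO C e A)) \<and>
     (\<forall>f g h. (f, g, h) \<in> Dist C \<longrightarrow> (fA F f, fA F g, fS F 1 (Src C f) \<cdot>\<^bsub>D\<^esub> fA F h) \<in> Dist D)"

text \<open>\<open>tS d A B : A[d] \<otimes> B \<rightarrow> (A \<otimes> B)[d]\<close> expresses that the tensor product is exact in its first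
  variable; exactness in the second follows by the symmetry.\<close>

record ('o, 'a) ttcat = "('o, 'a) tricat" +
  tO :: "'o \<Rightarrow> 'o \<Rightarrow> 'o"
  tA :: "'a \<Rightarrow> 'a \<Rightarrow> 'a"
  tI :: "'o"
  asc :: "'o \<Rightarrow> 'o \<Rightarrow> 'o \<Rightarrow> 'a"
  lun :: "'o \<Rightarrow> 'a"
  run :: "'o \<Rightarrow> 'a"
  symm :: "'o \<Rightarrow> 'o \<Rightarrow> 'a"
  tS :: "int \<Rightarrow> 'o \<Rightarrow> 'o \<Rightarrow> 'a"

locale tt_category = triangulated_category C
  for C :: "('o, 'a, 'e) ttcat_scheme" (structure) +
  assumes tO_Obj: "\<lbrakk>A \<in> Obj C; B \<in> Obj C\<rbrakk> \<Longrightarrow> tO C A B \<in> Obj C"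
    and tA_Hom: "\<lbrakk>f \<in> Hom C A A'; g \<in> Hom C B B'\<rbrakk> \<Longrightarrow> tA C f g \<in> Hom C (tO C A B) (tO C A' B')"
    and tA_Ident: "\<lbrakk>A \<in> Obj C; B \<in> Obj C\<rbrakk> \<Longrightarrow> tA C (Ident C A) (Ident C B) = Ident C (tO C A B)"
    and tA_Comp: "\<lbrakk>f \<in> Hom C A A'; f' \<in> Hom C A' A''; g \<in> Hom C B B'; g' \<in> Hom C B' B''\<rbrakk>
      \<Longrightarrow> tA C (f' \<cdot> f) (g' \<cdot> g) = tA C f' g' \<cdot> tA C f g"
    and One_Obj: "tI C \<in> Obj C"
    and asc_Hom: "\<lbrakk>A \<in> Obj C; B \<in> Obj C; E \<in> Obj C\<rbrakk>
      \<Longrightarrow> asc C A B E \<in> Hom C (tO C (tO C A B) E) (tO C A (tO C B E)) \<and> iso_arr C (asc C A B E)"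
    and asc_natural: "\<lbrakk>f \<in> Hom C A A'; g \<in> Hom C B B'; h \<in> Hom C E E'\<rbrakk>
      \<Longrightarrow> asc C A' B' E' \<cdot> tA C (tA C f g) h = tA C f (tA C g h) \<cdot> asc C A B E"
    and lun_Hom: "A \<in> Obj C \<Longrightarrow> lun C A \<in> Hom C (tO C (tI C) A) A \<and> iso_arr C (lun C A)"
    and lun_natural: "f \<in> Hom C A A' \<Longrightarrow> lun C A' \<cdot> tA C (Ident C (tI C)) f = f \<cdot> lun C A"
    and run_Hom: "A \<in> Obj C \<Longrightarrow> run C A \<in> Hom C (tO C A (tI C)) A \<and> iso_arr C (run C A)"
    and run_natural: "f \<in> Hom C A A' \<Longrightarrow> run C A' \<cdot> tA C f (Ident C (tI C)) = f \<cdot> run C A"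
    and sym_Hom: "\<lbrakk>A \<in> Obj C; B \<in> Obj C\<rbrakk> \<Longrightarrow> symm C A B \<in> Hom C (tO C A B) (tO C B A)"
    and sym_natural: "\<lbrakk>f \<in> Hom C A A'; g \<in> Hom C B B'\<rbrakk>
      \<Longrightarrow> symm C A' B' \<cdot> tA C f g = tA C g f \<cdot> symm C A B"
    and sym_sym: "\<lbrakk>A \<in> Obj C; B \<in> Obj C\<rbrakk> \<Longrightarrow> symm C B A \<cdot> symm C A B = Ident C (tO C A B)"
    and pentagon: "\<lbrakk>A \<in> Obj C; B \<in> Obj C; E \<in> Obj C; K \<in> Obj C\<rbrakk>
      \<Longrightarrow> asc C A B (tO C E K) \<cdot> asc C (tO C A B) E K =
         tA C (Ident C A) (asc C B E K) \<cdot> asc C A (tO C B E) K \<cdot> tA C (asc C A B E) (Ident C K)"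
    and triangle: "\<lbrakk>A \<in> Obj C; B \<in> Obj C\<rbrakk>
      \<Longrightarrow> tA C (Ident C A) (lun C B) \<cdot> asc C A (tI C) B = tA C (run C A) (Ident C B)"
    and hexagon: "\<lbrakk>A \<in> Obj C; B \<in> Obj C; E \<in> Obj C\<rbrakk>
      \<Longrightarrow> asc C B E A \<cdot> symm C A (tO C B E) \<cdot> asc C A B E =
         tA C (Ident C B) (symm C A E) \<cdot> asc C B A E \<cdot> tA C (symm C A B) (Ident C E)"
    and tensor_exact: "B \<in> Obj C \<Longrightarrow>
      exact_functor C C \<lparr>fO = (\<lambda>A. tO C A B), fA = (\<lambda>f. tA C f (Ident C B)), fS = (\<lambda>d A. tS C d A B)\<rparr>"
    and tS_natural: "\<lbrakk>A \<in> Obj C; g \<in> Hom C B B'\<rbrakk>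
      \<Longrightarrow> tS C d A B' \<cdot> tA C (Ident C (shO C d A)) g = shA C d (tA C (Ident C A) g) \<cdot> tS C d A B"

definition tS_right :: "('o, 'a, 'e) ttcat_scheme \<Rightarrow> int \<Rightarrow> 'o \<Rightarrow> 'o \<Rightarrow> 'a" where
  "tS_right C d A B = shA C d (symm C B A) \<cdot>\<^bsub>C\<^esub> tS C d B A \<cdot>\<^bsub>C\<^esub> symm C A (shO C d B)"

text \<open>\<open>A[d] \<otimes> B[e] \<rightarrow> (A \<otimes> B)[d + e]\<close>, moving the shift of the left factor out first; the other order
  would change it by the usual sign \<open>(-1)^(d e)\<close>.\<close>

definition tS_both :: "('o, 'a, 'e) ttcat_scheme \<Rightarrow> int \<Rightarrow> int \<Rightarrow> 'o \<Rightarrow> 'o \<Rightarrow> 'a" where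
  "tS_both C d e A B = shA C d (tS_right C e A B) \<cdot>\<^bsub>C\<^esub> tS C d A (shO C e B)"


section \<open>Spaces and the six-functor formalism\<close>

text \<open>Spaces form a category with a functor \<open>X \<mapsto> pt X\<close> to topological spaces, so that
  \<open>U = X \ Z\<close> has its usual meaning. For spaces that are not determined by their topology, such as
  schemes, being a closed immersion, an open immersion or a proper morphism is extra structure.\<close>

record ('x, 'm, 'p) spaces = "('x, 'm) cat" +
  pt :: "'x \<Rightarrow> 'p topology"
  ptm :: "'m \<Rightarrow> 'p \<Rightarrow> 'p"
  ClosedImm :: "'m set"
  OpenImm :: "'m set"
  Proper :: "'m set"

locale category_of_spaces = category S
  for S :: "('x, 'm, 'p, 'e) spaces_scheme" (structure) +
  assumes ptm_continuous: "f \<in> Arr S \<Longrightarrow> continuous_map (pt S (Src S f)) (pt S (Tgt S f)) (ptm S f)"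
    and ptm_Ident: "\<lbrakk>X \<in> Obj S; x \<in> topspace (pt S X)\<rbrakk> \<Longrightarrow> ptm S (Ident S X) x = x"
    and ptm_Comp: "\<lbrakk>f \<in> Hom S X Y; g \<in> Hom S Y T; x \<in> topspace (pt S X)\<rbrakk>
      \<Longrightarrow> ptm S (g \<cdot> f) x = ptm S g (ptm S f x)"
    and ClosedImm: "i \<in> ClosedImm S \<Longrightarrow> i \<in> Arr S \<and>
      embedding_map (pt S (Src S i)) (pt S (Tgt S i)) (ptm S i) \<and>
      closed_map (pt S (Src S i)) (pt S (Tgt S i)) (ptm S i)"
    and OpenImm: "j \<in> OpenImm S \<Longrightarrow> j \<in> Arr S \<and>
      embedding_map (pt S (Src S j)) (pt S (Tgt S j)) (ptm S j) \<and>
      open_map (pt S (Src S j)) (pt S (Tgt S j)) (ptm S j)"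
    and Proper: "p \<in> Proper S \<Longrightarrow> p \<in> Arr S"

definition open_complement :: "('x, 'm, 'p, 'e) spaces_scheme \<Rightarrow> 'm \<Rightarrow> 'm \<Rightarrow> bool" where
  "open_complement S i j \<longleftrightarrow> i \<in> ClosedImm S \<and> j \<in> OpenImm S \<and> Tgt S j = Tgt S i \<and>
     ptm S j ` topspace (pt S (Src S j)) =
       topspace (pt S (Tgt S i)) - ptm S i ` topspace (pt S (Src S i))"

text \<open>All categories \<open>Cat X\<close> share one type of objects and one type of arrows, but their carriers are
  unrelated. For \<open>f : X \<rightarrow> Y\<close>, \<open>g : Y \<rightarrow> T\<close>:
  \<^item> \<open>ups f = f\<^sup>*\<close> and \<open>los f = f\<^sub>*\<close> with unit \<open>aun f M : M \<rightarrow> f\<^sub>* f\<^sup>* M\<close> and counit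
    \<open>aco f M : f\<^sup>* f\<^sub>* M \<rightarrow> M\<close>;
  \<^item> \<open>mon f A B : f\<^sup>* A \<otimes> f\<^sup>* B \<rightarrow> f\<^sup>* (A \<otimes> B)\<close> and \<open>mon1 f : 1 \<rightarrow> f\<^sup>* 1\<close>;
  \<^item> \<open>pco g f M : f\<^sup>* g\<^sup>* M \<rightarrow> (g f)\<^sup>* M\<close> and \<open>pid X M : M \<rightarrow> id\<^sup>* M\<close>;
  \<^item> for \<open>f\<close> a closed immersion, \<open>exc f\<close> is the right adjoint of \<open>f\<^sub>*\<close> (written \<open>f\<^sup>!\<close>), with unit
    \<open>eun f M : M \<rightarrow> f\<^sup>! f\<^sub>* M\<close> and counit \<open>eco f M : f\<^sub>* f\<^sup>! M \<rightarrow> M\<close>;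
  \<^item> for \<open>f\<close> an open immersion, \<open>ext0 f\<close> is the left adjoint of \<open>f\<^sup>*\<close> (written \<open>f\<^sub>!\<close>), with unit
    \<open>oun f M : M \<rightarrow> f\<^sup>* f\<^sub>! M\<close> and counit \<open>oco f M : f\<^sub>! f\<^sup>* M \<rightarrow> M\<close>;
  \<^item> for \<open>f\<close> proper, \<open>pft f\<close> is the set of those natural transformations \<open>f\<^sub>* f\<^sup>* \<rightarrow> id\<close> that are used
    for pushforward along \<open>f\<close>.\<close>

record ('x, 'm, 'p, 'o, 'a) sixff =
  Sp :: "('x, 'm, 'p) spaces"
  Cat :: "'x \<Rightarrow> ('o, 'a) ttcat"
  ups :: "'m \<Rightarrow> ('o, 'a, 'o, 'a) xfctr"
  los :: "'m \<Rightarrow> ('o, 'a, 'o, 'a) xfctr"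
  aun :: "'m \<Rightarrow> 'o \<Rightarrow> 'a"
  aco :: "'m \<Rightarrow> 'o \<Rightarrow> 'a"
  mon :: "'m \<Rightarrow> 'o \<Rightarrow> 'o \<Rightarrow> 'a"
  mon1 :: "'m \<Rightarrow> 'a"
  pco :: "'m \<Rightarrow> 'm \<Rightarrow> 'o \<Rightarrow> 'a"
  pid :: "'x \<Rightarrow> 'o \<Rightarrow> 'a"
  exc :: "'m \<Rightarrow> ('o, 'a, 'o, 'a) xfctr"
  eun :: "'m \<Rightarrow> 'o \<Rightarrow> 'a"
  eco :: "'m \<Rightarrow> 'o \<Rightarrow> 'a"
  ext0 :: "'m \<Rightarrow> ('o, 'a, 'o, 'a) xfctr"
  oun :: "'m \<Rightarrow> 'o \<Rightarrow> 'a"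
  oco :: "'m \<Rightarrow> 'o \<Rightarrow> 'a"
  pft :: "'m \<Rightarrow> ('o \<Rightarrow> 'a) set"

abbreviation src where "src F f \<equiv> Src (Sp F) f"
abbreviation tgt where "tgt F f \<equiv> Tgt (Sp F) f"
abbreviation upO where "upO F f \<equiv> fO (ups F f)"
abbreviation upA where "upA F f \<equiv> fA (ups F f)"
abbreviation upS where "upS F f \<equiv> fS (ups F f)"
abbreviation loO where "loO F f \<equiv> fO (los F f)"
abbreviation loA where "loA F f \<equiv> fA (los F f)"
abbreviation exO where "exO F f \<equiv> fO (exc F f)"
abbreviation exA where "exA F f \<equiv> fA (exc F f)"

locale symmetric_monoidal_pullback =
  fixes F :: "('x, 'm, 'p, 'o, 'a) sixff" and f :: 'm and C D :: "('o, 'a) ttcat"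
  assumes mon1_Hom: "mon1 F f \<in> Hom D (tI D) (upO F f (tI C)) \<and> iso_arr D (mon1 F f)"
    and mon_Hom: "\<lbrakk>A \<in> Obj C; B \<in> Obj C\<rbrakk> \<Longrightarrow>
      mon F f A B \<in> Hom D (tO D (upO F f A) (upO F f B)) (upO F f (tO C A B)) \<and>
      iso_arr D (mon F f A B)"
    and mon_natural: "\<lbrakk>\<phi> \<in> Hom C A A'; \<psi> \<in> Hom C B B'\<rbrakk> \<Longrightarrow>
      mon F f A' B' \<cdot>\<^bsub>D\<^esub> tA D (upA F f \<phi>) (upA F f \<psi>) = upA F f (tA C \<phi> \<psi>) \<cdot>\<^bsub>D\<^esub> mon F f A B"
    and mon_asc: "\<lbrakk>A \<in> Obj C; B \<in> Obj C; E \<in> Obj C\<rbrakk> \<Longrightarrow>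
      upA F f (asc C A B E) \<cdot>\<^bsub>D\<^esub> mon F f (tO C A B) E \<cdot>\<^bsub>D\<^esub> tA D (mon F f A B) (Ident D (upO F f E)) =
      mon F f A (tO C B E) \<cdot>\<^bsub>D\<^esub> tA D (Ident D (upO F f A)) (mon F f B E) \<cdot>\<^bsub>D\<^esub>
        asc D (upO F f A) (upO F f B) (upO F f E)"
    and mon_lun: "A \<in> Obj C \<Longrightarrow>
      upA F f (lun C A) \<cdot>\<^bsub>D\<^esub> mon F f (tI C) A \<cdot>\<^bsub>D\<^esub> tA D (mon1 F f) (Ident D (upO F f A)) =
      lun D (upO F f A)"
    and mon_run: "A \<in> Obj C \<Longrightarrow>
      upA F f (run C A) \<cdot>\<^bsub>D\<^esub> mon F f A (tI C) \<cdot>\<^bsub>D\<^esub> tA D (Ident D (upO F f A)) (mon1 F f) =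
      run D (upO F f A)"
    and mon_sym: "\<lbrakk>A \<in> Obj C; B \<in> Obj C\<rbrakk> \<Longrightarrow>
      upA F f (symm C A B) \<cdot>\<^bsub>D\<^esub> mon F f A B = mon F f B A \<cdot>\<^bsub>D\<^esub> symm D (upO F f A) (upO F f B)"

locale six_functor_formalism =
  fixes F :: "('x, 'm, 'p, 'o, 'a) sixff"
  assumes spaces: "category_of_spaces (Sp F)"
    and Cat_tt: "X \<in> Obj (Sp F) \<Longrightarrow> tt_category (Cat F X)"
    and ups_exact: "f \<in> Hom (Sp F) X Y \<Longrightarrow> exact_functor (Cat F Y) (Cat F X) (ups F f)"
    and los_exact: "f \<in> Hom (Sp F) X Y \<Longrightarrow> exact_functor (Cat F X) (Cat F Y) (los F f)"
    and ups_los: "f \<in> Hom (Sp F) X Y \<Longrightarrow>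
      adjunction (Cat F Y) (Cat F X) (ups F f) (los F f) (aun F f) (aco F f)"
    and ups_monoidal: "f \<in> Hom (Sp F) X Y \<Longrightarrow>
      symmetric_monoidal_pullback F f (Cat F Y) (Cat F X)"
    and pco_iso: "\<lbrakk>f \<in> Hom (Sp F) X Y; g \<in> Hom (Sp F) Y T\<rbrakk> \<Longrightarrow>
      nat_iso (Cat F T) (Cat F X) (comp_fctr (ups F f) (ups F g)) (ups F (g \<cdot>\<^bsub>Sp F\<^esub> f)) (pco F g f)"
    and pid_iso: "X \<in> Obj (Sp F) \<Longrightarrow>
      nat_iso (Cat F X) (Cat F X) id_fctr (ups F (Ident (Sp F) X)) (pid F X)"
    and pco_assoc: "\<lbrakk>f \<in> Hom (Sp F) X Y; g \<in> Hom (Sp F) Y T; h \<in> Hom (Sp F) T T';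
        M \<in> Obj (Cat F T')\<rbrakk> \<Longrightarrow>
      pco F h (g \<cdot>\<^bsub>Sp F\<^esub> f) M \<cdot>\<^bsub>Cat F X\<^esub> pco F g f (upO F h M) =
      pco F (h \<cdot>\<^bsub>Sp F\<^esub> g) f M \<cdot>\<^bsub>Cat F X\<^esub> upA F f (pco F h g M)"
    and pco_pid: "\<lbrakk>f \<in> Hom (Sp F) X Y; M \<in> Obj (Cat F Y)\<rbrakk> \<Longrightarrow>
      pco F f (Ident (Sp F) X) M \<cdot>\<^bsub>Cat F X\<^esub> pid F X (upO F f M) = Ident (Cat F X) (upO F f M) \<and>
      pco F (Ident (Sp F) Y) f M \<cdot>\<^bsub>Cat F X\<^esub> upA F f (pid F Y M) = Ident (Cat F X) (upO F f M)"
    and pco_mon1: "\<lbrakk>f \<in> Hom (Sp F) X Y; g \<in> Hom (Sp F) Y T\<rbrakk> \<Longrightarrow>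
      mon1 F (g \<cdot>\<^bsub>Sp F\<^esub> f) =
      pco F g f (tI (Cat F T)) \<cdot>\<^bsub>Cat F X\<^esub> upA F f (mon1 F g) \<cdot>\<^bsub>Cat F X\<^esub> mon1 F f"
    and pco_mon: "\<lbrakk>f \<in> Hom (Sp F) X Y; g \<in> Hom (Sp F) Y T;
        A \<in> Obj (Cat F T); B \<in> Obj (Cat F T)\<rbrakk> \<Longrightarrow>
      mon F (g \<cdot>\<^bsub>Sp F\<^esub> f) A B \<cdot>\<^bsub>Cat F X\<^esub> tA (Cat F X) (pco F g f A) (pco F g f B) =
      pco F g f (tO (Cat F T) A B) \<cdot>\<^bsub>Cat F X\<^esub> upA F f (mon F g A B) \<cdot>\<^bsub>Cat F X\<^esub>
        mon F f (upO F g A) (upO F g B)"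
    and pco_shift: "\<lbrakk>f \<in> Hom (Sp F) X Y; g \<in> Hom (Sp F) Y T; M \<in> Obj (Cat F T)\<rbrakk> \<Longrightarrow>
      upS F (g \<cdot>\<^bsub>Sp F\<^esub> f) d M \<cdot>\<^bsub>Cat F X\<^esub> pco F g f (shO (Cat F T) d M) =
      shA (Cat F X) d (pco F g f M) \<cdot>\<^bsub>Cat F X\<^esub> upS F f d (upO F g M) \<cdot>\<^bsub>Cat F X\<^esub>
        upA F f (upS F g d M)"
    and pft_nat: "\<lbrakk>p \<in> Proper (Sp F); p \<in> Hom (Sp F) X Y; \<epsilon> \<in> pft F p\<rbrakk> \<Longrightarrow>
      nat_trans (Cat F Y) (Cat F Y) (comp_fctr (los F p) (ups F p)) id_fctr \<epsilon>"

definition recollement :: "('x, 'm, 'p, 'o, 'a) sixff \<Rightarrow> 'm \<Rightarrow> 'm \<Rightarrow> bool" where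
  "recollement F i j \<longleftrightarrow> open_complement (Sp F) i j \<and>
    (let CX = Cat F (tgt F i); CZ = Cat F (src F i); CU = Cat F (src F j) in
      exact_functor CX CZ (exc F i) \<and>
      adjunction CZ CX (los F i) (exc F i) (eun F i) (eco F i) \<and>
      exact_functor CU CX (ext0 F j) \<and>
      adjunction CU CX (ext0 F j) (ups F j) (oun F j) (oco F j) \<and>
      fully_faithful CZ CX (los F i) \<and>
      fully_faithful CU CX (ext0 F j) \<and>
      (\<forall>M \<in> Obj CZ. is_zero CU (upO F j (loO F i M))) \<and>
      (\<forall>N \<in> Obj CU. is_zero CZ (upO F i (fO (ext0 F j) N))) \<and>
      (\<exists>\<delta>. nat_trans CX CX (comp_fctr (los F i) (ups F i))
             (comp_fctr (shift_fctr CX 1) (comp_fctr (ext0 F j) (ups F j))) \<delta> \<and>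
           (\<forall>M \<in> Obj CX. (oco F j M, aun F i M, \<delta> M) \<in> Dist CX)) \<and>
      (\<exists>\<delta>. nat_trans CX CX (comp_fctr (los F j) (ups F j))
             (comp_fctr (shift_fctr CX 1) (comp_fctr (los F i) (exc F i))) \<delta> \<and>
           (\<forall>M \<in> Obj CX. (eco F i M, aun F j M, \<delta> M) \<in> Dist CX)))"


section \<open>Cohomology, supports and localized classes\<close>

definition coh :: "('x, 'm, 'p, 'o, 'a) sixff \<Rightarrow> 'x \<Rightarrow> 'o \<Rightarrow> int \<Rightarrow> 'a set" where
  "coh F X A d = Hom (Cat F X) (tI (Cat F X)) (shO (Cat F X) d A)"

text \<open>For \<open>f : X \<rightarrow> Y\<close> and \<open>c \<in> H\<^sup>d(Y; A)\<close>, the class \<open>f\<^sup>* c \<in> H\<^sup>d(X; f\<^sup>* A)\<close>.\<close>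

definition pull :: "('x, 'm, 'p, 'o, 'a) sixff \<Rightarrow> 'm \<Rightarrow> 'o \<Rightarrow> int \<Rightarrow> 'a \<Rightarrow> 'a" where
  "pull F f A d c = upS F f d A \<cdot>\<^bsub>Cat F (src F f)\<^esub> upA F f c \<cdot>\<^bsub>Cat F (src F f)\<^esub> mon1 F f"

definition supported :: "('x, 'm, 'p, 'o, 'a) sixff \<Rightarrow> 'm \<Rightarrow> 'o \<Rightarrow> int \<Rightarrow> 'a set" where
  "supported F j A d = {c \<in> coh F (tgt F j) A d. pull F j A d c =
     zeroA (Cat F (src F j)) (tI (Cat F (src F j))) (shO (Cat F (src F j)) d (upO F j A))}"

text \<open>Throughout, \<open>i\<^sup>! A[d]\<close> is read as \<open>i\<^sup>! (A[d])\<close>.\<close>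

definition coh_supp :: "('x, 'm, 'p, 'o, 'a) sixff \<Rightarrow> 'm \<Rightarrow> 'o \<Rightarrow> int \<Rightarrow> 'a set" where
  "coh_supp F i A d = Hom (Cat F (tgt F i)) (tI (Cat F (tgt F i)))
     (loO F i (exO F i (shO (Cat F (tgt F i)) d A)))"

definition loc_grp :: "('x, 'm, 'p, 'o, 'a) sixff \<Rightarrow> 'm \<Rightarrow> 'o \<Rightarrow> int \<Rightarrow> 'a set" where
  "loc_grp F i A d = Hom (Cat F (src F i)) (tI (Cat F (src F i)))
     (exO F i (shO (Cat F (tgt F i)) d A))"

definition forg :: "('x, 'm, 'p, 'o, 'a) sixff \<Rightarrow> 'm \<Rightarrow> 'o \<Rightarrow> int \<Rightarrow> 'a \<Rightarrow> 'a" where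
  "forg F i A d c' = eco F i (shO (Cat F (tgt F i)) d A) \<cdot>\<^bsub>Cat F (tgt F i)\<^esub> c'"

text \<open>The bijection \<open>Hom(1\<^sub>X, i\<^sub>* N) = Hom(1\<^sub>Z, N)\<close> given by the adjunction and \<open>i\<^sup>* 1\<^sub>X = 1\<^sub>Z\<close>, and
  its inverse.\<close>

definition adj :: "('x, 'm, 'p, 'o, 'a) sixff \<Rightarrow> 'm \<Rightarrow> 'o \<Rightarrow> 'a \<Rightarrow> 'a" where
  "adj F i N \<phi> = aco F i N \<cdot>\<^bsub>Cat F (src F i)\<^esub> upA F i \<phi> \<cdot>\<^bsub>Cat F (src F i)\<^esub> mon1 F i"

definition adj_inv :: "('x, 'm, 'p, 'o, 'a) sixff \<Rightarrow> 'm \<Rightarrow> 'a \<Rightarrow> 'a" where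
  "adj_inv F i \<mu> = loA F i (\<mu> \<cdot>\<^bsub>Cat F (src F i)\<^esub> invar (Cat F (src F i)) (mon1 F i))
     \<cdot>\<^bsub>Cat F (tgt F i)\<^esub> aun F i (tI (Cat F (tgt F i)))"

definition Lift :: "('x, 'm, 'p, 'o, 'a) sixff \<Rightarrow> 'm \<Rightarrow> 'o \<Rightarrow> int \<Rightarrow> 'a \<Rightarrow> 'a set" where
  "Lift F i A d c = {c' \<in> coh_supp F i A d. forg F i A d c' = c}"

definition Loc_tor :: "('x, 'm, 'p, 'o, 'a) sixff \<Rightarrow> 'm \<Rightarrow> 'o \<Rightarrow> int \<Rightarrow> 'a \<Rightarrow> 'a set" where
  "Loc_tor F i A d c = adj F i (exO F i (shO (Cat F (tgt F i)) d A)) ` Lift F i A d c"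

definition Loc :: "('x, 'm, 'p, 'o, 'a) sixff \<Rightarrow> 'm \<Rightarrow> 'o \<Rightarrow> int \<Rightarrow> 'a \<Rightarrow> 'a" where
  "Loc F i A d c = the_elem (Loc_tor F i A d c)"


section \<open>Exchange morphisms\<close>

text \<open>For a commutative square \<open>a b = c d\<close>: \<open>b\<^sup>* a\<^sup>* M \<rightarrow> d\<^sup>* c\<^sup>* M\<close>.\<close>

definition exch ::
  "('x, 'm, 'p, 'o, 'a) sixff \<Rightarrow> 'm \<Rightarrow> 'm \<Rightarrow> 'm \<Rightarrow> 'm \<Rightarrow> 'o \<Rightarrow> 'a" where
  "exch F a b c d M = invar (Cat F (src F b)) (pco F c d M) \<cdot>\<^bsub>Cat F (src F b)\<^esub> pco F a b M"

text \<open>For \<open>i g\<^sub>Z = g i'\<close>, the Beck--Chevalley morphisms \<open>g\<^sup>* i\<^sub>* M \<rightarrow> i'\<^sub>* g\<^sub>Z\<^sup>* M\<close> (adjoint to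
  \<open>i'\<^sup>* g\<^sup>* i\<^sub>* M = g\<^sub>Z\<^sup>* i\<^sup>* i\<^sub>* M \<rightarrow> g\<^sub>Z\<^sup>* M\<close>) and \<open>g\<^sub>Z\<^sup>* i\<^sup>! N \<rightarrow> i'\<^sup>! g\<^sup>* N\<close> (adjoint to
  \<open>i'\<^sub>* g\<^sub>Z\<^sup>* i\<^sup>! N = g\<^sup>* i\<^sub>* i\<^sup>! N \<rightarrow> g\<^sup>* N\<close>, which uses that the first one is invertible).\<close>

definition bc_star ::
  "('x, 'm, 'p, 'o, 'a) sixff \<Rightarrow> 'm \<Rightarrow> 'm \<Rightarrow> 'm \<Rightarrow> 'm \<Rightarrow> 'o \<Rightarrow> 'a" where
  "bc_star F i gZ g i' M =
     loA F i' (upA F gZ (aco F i M) \<cdot>\<^bsub>Cat F (src F i')\<^esub> exch F g i' i gZ (loO F i M))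
     \<cdot>\<^bsub>Cat F (tgt F i')\<^esub> aun F i' (upO F g (loO F i M))"

definition bc_shriek ::
  "('x, 'm, 'p, 'o, 'a) sixff \<Rightarrow> 'm \<Rightarrow> 'm \<Rightarrow> 'm \<Rightarrow> 'm \<Rightarrow> 'o \<Rightarrow> 'a" where
  "bc_shriek F i gZ g i' N =
     exA F i' (upA F g (eco F i N) \<cdot>\<^bsub>Cat F (tgt F i')\<^esub>
               invar (Cat F (tgt F i')) (bc_star F i gZ g i' (exO F i N)))
     \<cdot>\<^bsub>Cat F (src F i')\<^esub> eun F i' (upO F gZ (exO F i N))"

definition bc_isos :: "('x, 'm, 'p, 'o, 'a) sixff \<Rightarrow> 'm \<Rightarrow> 'm \<Rightarrow> 'm \<Rightarrow> 'm \<Rightarrow> bool" where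
  "bc_isos F i gZ g i' \<longleftrightarrow>
     (\<forall>M \<in> Obj (Cat F (src F i)). iso_arr (Cat F (tgt F i')) (bc_star F i gZ g i' M)) \<and>
     (\<forall>N \<in> Obj (Cat F (tgt F i)). iso_arr (Cat F (src F i')) (bc_shriek F i gZ g i' N))"

text \<open>For \<open>p i = k p\<^sub>Z\<close>, the morphism \<open>k\<^sub>* p\<^sub>Z\<^sub>* M \<rightarrow> p\<^sub>* i\<^sub>* M\<close> conjugate to
  \<open>i\<^sup>* p\<^sup>* = p\<^sub>Z\<^sup>* k\<^sup>*\<close>, and the morphism \<open>p\<^sub>Z\<^sub>* i\<^sup>! N \<rightarrow> k\<^sup>! p\<^sub>* N\<close> adjoint to
  \<open>k\<^sub>* p\<^sub>Z\<^sub>* i\<^sup>! N = p\<^sub>* i\<^sub>* i\<^sup>! N \<rightarrow> p\<^sub>* N\<close>.\<close>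

definition exch_low ::
  "('x, 'm, 'p, 'o, 'a) sixff \<Rightarrow> 'm \<Rightarrow> 'm \<Rightarrow> 'm \<Rightarrow> 'm \<Rightarrow> 'o \<Rightarrow> 'a" where
  "exch_low F p i k pZ M =
     (let CX = Cat F (tgt F i); CY = Cat F (tgt F p); CZ = Cat F (src F i);
          K = loO F k (loO F pZ M) in
      loA F p
        (loA F i (aco F pZ M \<cdot>\<^bsub>CZ\<^esub> upA F pZ (aco F k (loO F pZ M)) \<cdot>\<^bsub>CZ\<^esub> exch F p i k pZ K)
         \<cdot>\<^bsub>CX\<^esub> aun F i (upO F p K))
      \<cdot>\<^bsub>CY\<^esub> aun F p K)"

definition bc_proper ::
  "('x, 'm, 'p, 'o, 'a) sixff \<Rightarrow> 'm \<Rightarrow> 'm \<Rightarrow> 'm \<Rightarrow> 'm \<Rightarrow> 'o \<Rightarrow> 'a" where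
  "bc_proper F p i k pZ N =
     exA F k (loA F p (eco F i N) \<cdot>\<^bsub>Cat F (tgt F p)\<^esub> exch_low F p i k pZ (exO F i N))
     \<cdot>\<^bsub>Cat F (src F k)\<^esub> eun F k (loO F pZ (exO F i N))"

definition bc_proper_isos :: "('x, 'm, 'p, 'o, 'a) sixff \<Rightarrow> 'm \<Rightarrow> 'm \<Rightarrow> 'm \<Rightarrow> 'm \<Rightarrow> bool" where
  "bc_proper_isos F p i k pZ \<longleftrightarrow>
     (\<forall>M \<in> Obj (Cat F (src F k)). iso_arr (Cat F (tgt F i)) (bc_star F k pZ p i M)) \<and>
     (\<forall>N \<in> Obj (Cat F (tgt F i)). iso_arr (Cat F (src F k)) (bc_proper F p i k pZ N))"


section \<open>External products\<close>

text \<open>Here \<open>a : P \<rightarrow> X\<close>, \<open>b : P \<rightarrow> Y\<close> are the projections of a product \<open>P = X \<times> Y\<close>, and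
  \<open>a' : Q \<rightarrow> Z\<close>, \<open>b' : Q \<rightarrow> Y\<close> those of \<open>Q = Z \<times> Y\<close>; \<open>iY : Q \<rightarrow> P\<close> is \<open>i \<times> id\<close>.\<close>

definition ext_ob :: "('x, 'm, 'p, 'o, 'a) sixff \<Rightarrow> 'm \<Rightarrow> 'm \<Rightarrow> 'o \<Rightarrow> 'o \<Rightarrow> 'o" where
  "ext_ob F a b A B = tO (Cat F (src F a)) (upO F a A) (upO F b B)"

definition ext_ar :: "('x, 'm, 'p, 'o, 'a) sixff \<Rightarrow> 'm \<Rightarrow> 'm \<Rightarrow> 'a \<Rightarrow> 'a \<Rightarrow> 'a" where
  "ext_ar F a b \<phi> \<psi> = tA (Cat F (src F a)) (upA F a \<phi>) (upA F b \<psi>)"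

text \<open>\<open>1 \<rightarrow> 1 \<boxtimes> 1\<close> and \<open>A[d] \<boxtimes> B[e] \<rightarrow> (A \<boxtimes> B)[d + e]\<close>.\<close>

definition ext_one :: "('x, 'm, 'p, 'o, 'a) sixff \<Rightarrow> 'm \<Rightarrow> 'm \<Rightarrow> 'a" where
  "ext_one F a b = tA (Cat F (src F a)) (mon1 F a) (mon1 F b) \<cdot>\<^bsub>Cat F (src F a)\<^esub>
     invar (Cat F (src F a)) (lun (Cat F (src F a)) (tI (Cat F (src F a))))"

definition ext_shift ::
  "('x, 'm, 'p, 'o, 'a) sixff \<Rightarrow> 'm \<Rightarrow> 'm \<Rightarrow> int \<Rightarrow> int \<Rightarrow> 'o \<Rightarrow> 'o \<Rightarrow> 'a" where
  "ext_shift F a b d e A B = tS_both (Cat F (src F a)) d e (upO F a A) (upO F b B)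
     \<cdot>\<^bsub>Cat F (src F a)\<^esub> tA (Cat F (src F a)) (upS F a d A) (upS F b e B)"

definition ext_class ::
  "('x, 'm, 'p, 'o, 'a) sixff \<Rightarrow> 'm \<Rightarrow> 'm \<Rightarrow> 'o \<Rightarrow> 'o \<Rightarrow> int \<Rightarrow> int \<Rightarrow> 'a \<Rightarrow> 'a \<Rightarrow> 'a" where
  "ext_class F a b A B d e c \<beta> =
     ext_shift F a b d e A B \<cdot>\<^bsub>Cat F (src F a)\<^esub> ext_ar F a b c \<beta> \<cdot>\<^bsub>Cat F (src F a)\<^esub> ext_one F a b"

text \<open>\<open>iY\<^sup>* (M \<boxtimes> B) \<rightarrow> i\<^sup>* M \<boxtimes> B\<close>; then \<open>i\<^sub>* M \<boxtimes> B \<rightarrow> iY\<^sub>* (M \<boxtimes> B)\<close>, adjoint to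
  \<open>iY\<^sup>* (i\<^sub>* M \<boxtimes> B) = i\<^sup>* i\<^sub>* M \<boxtimes> B \<rightarrow> M \<boxtimes> B\<close>; then \<open>i\<^sup>! N \<boxtimes> B \<rightarrow> iY\<^sup>! (N \<boxtimes> B)\<close>, adjoint to
  \<open>iY\<^sub>* (i\<^sup>! N \<boxtimes> B) = i\<^sub>* i\<^sup>! N \<boxtimes> B \<rightarrow> N \<boxtimes> B\<close>.\<close>

definition ext_up ::
  "('x, 'm, 'p, 'o, 'a) sixff \<Rightarrow> 'm \<Rightarrow> 'm \<Rightarrow> 'm \<Rightarrow> 'm \<Rightarrow> 'm \<Rightarrow> 'm \<Rightarrow> 'o \<Rightarrow> 'o \<Rightarrow> 'a" where
  "ext_up F i iY a b a' b' M B =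
     tA (Cat F (src F iY)) (exch F a iY i a' M) (pco F b iY B) \<cdot>\<^bsub>Cat F (src F iY)\<^esub>
     invar (Cat F (src F iY)) (mon F iY (upO F a M) (upO F b B))"

definition ext_low ::
  "('x, 'm, 'p, 'o, 'a) sixff \<Rightarrow> 'm \<Rightarrow> 'm \<Rightarrow> 'm \<Rightarrow> 'm \<Rightarrow> 'm \<Rightarrow> 'm \<Rightarrow> 'o \<Rightarrow> 'o \<Rightarrow> 'a" where
  "ext_low F i iY a b a' b' M B =
     loA F iY (ext_ar F a' b' (aco F i M) (Ident (Cat F (tgt F b)) B)
               \<cdot>\<^bsub>Cat F (src F iY)\<^esub> ext_up F i iY a b a' b' (loO F i M) B)
     \<cdot>\<^bsub>Cat F (tgt F iY)\<^esub> aun F iY (ext_ob F a b (loO F i M) B)"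

definition ext_exc ::
  "('x, 'm, 'p, 'o, 'a) sixff \<Rightarrow> 'm \<Rightarrow> 'm \<Rightarrow> 'm \<Rightarrow> 'm \<Rightarrow> 'm \<Rightarrow> 'm \<Rightarrow> 'o \<Rightarrow> 'o \<Rightarrow> 'a" where
  "ext_exc F i iY a b a' b' N B =
     exA F iY (ext_ar F a b (eco F i N) (Ident (Cat F (tgt F b)) B) \<cdot>\<^bsub>Cat F (tgt F iY)\<^esub>
               invar (Cat F (tgt F iY)) (ext_low F i iY a b a' b' (exO F i N) B))
     \<cdot>\<^bsub>Cat F (src F iY)\<^esub> eun F iY (ext_ob F a' b' (exO F i N) B)"

definition ext_isos ::
  "('x, 'm, 'p, 'o, 'a) sixff \<Rightarrow> 'm \<Rightarrow> 'm \<Rightarrow> 'm \<Rightarrow> 'm \<Rightarrow> 'm \<Rightarrow> 'm \<Rightarrow> bool" where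
  "ext_isos F i iY a b a' b' \<longleftrightarrow> (\<forall>B \<in> Obj (Cat F (tgt F b)).
     (\<forall>M \<in> Obj (Cat F (src F i)). iso_arr (Cat F (tgt F iY)) (ext_low F i iY a b a' b' M B)) \<and>
     (\<forall>N \<in> Obj (Cat F (tgt F i)). iso_arr (Cat F (src F iY)) (ext_exc F i iY a b a' b' N B)))"


section \<open>Operations on classes and localized classes\<close>

text \<open>\<open>g\<^sub>Z\<^sup>* \<mu>\<close> for \<open>\<mu> : 1 \<rightarrow> i\<^sup>! A[d]\<close>, as a morphism \<open>1 \<rightarrow> i'\<^sup>! (g\<^sup>* A)[d]\<close>.\<close>

definition loc_pull ::
  "('x, 'm, 'p, 'o, 'a) sixff \<Rightarrow> 'm \<Rightarrow> 'm \<Rightarrow> 'm \<Rightarrow> 'm \<Rightarrow> 'o \<Rightarrow> int \<Rightarrow> 'a \<Rightarrow> 'a" where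
  "loc_pull F i gZ g i' A d \<mu> =
     (let CZ' = Cat F (src F i') in
      exA F i' (upS F g d A) \<cdot>\<^bsub>CZ'\<^esub> bc_shriek F i gZ g i' (shO (Cat F (tgt F i)) d A) \<cdot>\<^bsub>CZ'\<^esub>
      upA F gZ \<mu> \<cdot>\<^bsub>CZ'\<^esub> mon1 F gZ)"

text \<open>\<open>1\<^sub>Y \<rightarrow> p\<^sub>* 1\<^sub>X\<close>.\<close>

definition push_one :: "('x, 'm, 'p, 'o, 'a) sixff \<Rightarrow> 'm \<Rightarrow> 'a" where
  "push_one F p = loA F p (invar (Cat F (src F p)) (mon1 F p)) \<cdot>\<^bsub>Cat F (tgt F p)\<^esub>
     aun F p (tI (Cat F (tgt F p)))"

text \<open>\<open>p\<^sub>* c\<close> for \<open>c \<in> H\<^sup>d(X; p\<^sup>* A)\<close>, and \<open>(p\<^sub>Z)\<^sub>* \<mu>\<close> for \<open>\<mu> : 1 \<rightarrow> i\<^sup>! (p\<^sup>* A)[d]\<close>. As for \<open>i\<^sup>!\<close> above, the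
  transformation \<open>\<epsilon>\<close> is taken at \<open>A[d]\<close>, so \<open>(p\<^sup>* A)[d]\<close> is first identified with \<open>p\<^sup>* (A[d])\<close>.\<close>

definition push ::
  "('x, 'm, 'p, 'o, 'a) sixff \<Rightarrow> 'm \<Rightarrow> ('o \<Rightarrow> 'a) \<Rightarrow> 'o \<Rightarrow> int \<Rightarrow> 'a \<Rightarrow> 'a" where
  "push F p \<epsilon> A d c =
     \<epsilon> (shO (Cat F (tgt F p)) d A) \<cdot>\<^bsub>Cat F (tgt F p)\<^esub>
     loA F p (invar (Cat F (src F p)) (upS F p d A) \<cdot>\<^bsub>Cat F (src F p)\<^esub> c) \<cdot>\<^bsub>Cat F (tgt F p)\<^esub>
     push_one F p"

definition loc_push ::
  "('x, 'm, 'p, 'o, 'a) sixff \<Rightarrow> 'm \<Rightarrow> 'm \<Rightarrow> 'm \<Rightarrow> 'm \<Rightarrow> ('o \<Rightarrow> 'a) \<Rightarrow> 'o \<Rightarrow> int \<Rightarrow> 'a \<Rightarrow> 'a" where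
  "loc_push F p i k pZ \<epsilon> A d \<mu> =
     (let CW = Cat F (src F k); Ad = shO (Cat F (tgt F p)) d A in
      exA F k (\<epsilon> Ad) \<cdot>\<^bsub>CW\<^esub> bc_proper F p i k pZ (upO F p Ad) \<cdot>\<^bsub>CW\<^esub>
      loA F pZ (exA F i (invar (Cat F (src F p)) (upS F p d A)) \<cdot>\<^bsub>Cat F (src F i)\<^esub> \<mu>) \<cdot>\<^bsub>CW\<^esub>
      push_one F pZ)"

text \<open>\<open>\<mu> \<boxtimes> \<beta>\<close> for \<open>\<mu> : 1 \<rightarrow> i\<^sup>! A[d]\<close>, as a morphism \<open>1 \<rightarrow> iY\<^sup>! (A \<boxtimes> B)[d + e]\<close>.\<close>

definition loc_ext_class ::
  "('x, 'm, 'p, 'o, 'a) sixff \<Rightarrow> 'm \<Rightarrow> 'm \<Rightarrow> 'm \<Rightarrow> 'm \<Rightarrow> 'm \<Rightarrow> 'm \<Rightarrow> 'o \<Rightarrow> 'o \<Rightarrow> int \<Rightarrow> int \<Rightarrow> 'a \<Rightarrow> 'a \<Rightarrow> 'a"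
  where "loc_ext_class F i iY a b a' b' A B d e \<mu> \<beta> =
     (let CQ = Cat F (src F iY) in
      exA F iY (ext_shift F a b d e A B) \<cdot>\<^bsub>CQ\<^esub>
      ext_exc F i iY a b a' b' (shO (Cat F (tgt F i)) d A) (shO (Cat F (tgt F b)) e B) \<cdot>\<^bsub>CQ\<^esub>
      ext_ar F a' b' \<mu> \<beta> \<cdot>\<^bsub>CQ\<^esub> ext_one F a' b')"

text \<open>For \<open>i = v i\<^sub>V\<close> with \<open>v\<close> open, the morphism \<open>i\<^sup>! N \<rightarrow> i\<^sub>V\<^sup>! v\<^sup>* N\<close>: it is the Beck--Chevalley
  morphism of the square \<open>i id = v i\<^sub>V\<close>.\<close>

definition excision_map :: "('x, 'm, 'p, 'o, 'a) sixff \<Rightarrow> 'm \<Rightarrow> 'm \<Rightarrow> 'm \<Rightarrow> 'o \<Rightarrow> 'a" where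
  "excision_map F i v iV N =
     bc_shriek F i (Ident (Sp F) (src F i)) v iV N \<cdot>\<^bsub>Cat F (src F i)\<^esub> pid F (src F i) (exO F i N)"


section \<open>Hypotheses on an assignment of localized classes\<close>

text \<open>An assignment \<open>\<Lambda>\<close> takes a closed immersion \<open>i : Z \<rightarrow> X\<close>, a coefficient object \<open>A\<close>, a degree \<open>d\<close>
  and a class \<open>c\<close>. Only its values on classes vanishing on the open complement matter, which is why
  each compatibility is required just when the classes on both sides have this property.\<close>

type_synonym ('m, 'o, 'a) assignment = "'m \<Rightarrow> 'o \<Rightarrow> int \<Rightarrow> 'a \<Rightarrow> 'a"

definition localizes ::
  "('x, 'm, 'p, 'o, 'a) sixff \<Rightarrow> ('m, 'o, 'a) assignment \<Rightarrow> bool" where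
  "localizes F \<Lambda> \<longleftrightarrow> (\<forall>i j. recollement F i j \<longrightarrow>
     (\<forall>A \<in> Obj (Cat F (tgt F i)). \<forall>d. \<forall>c \<in> supported F j A d. \<Lambda> i A d c \<in> loc_grp F i A d))"

definition triangle_compatible ::
  "('x, 'm, 'p, 'o, 'a) sixff \<Rightarrow> 'm \<Rightarrow> 'm \<Rightarrow> ('m, 'o, 'a) assignment \<Rightarrow> bool" where
  "triangle_compatible F i j \<Lambda> \<longleftrightarrow>
     (\<forall>A \<in> Obj (Cat F (tgt F i)). \<forall>d. \<forall>c \<in> supported F j A d.
        eco F i (shO (Cat F (tgt F i)) d A) \<cdot>\<^bsub>Cat F (tgt F i)\<^esub> adj_inv F i (\<Lambda> i A d c) = c)"

definition base_change_compatible ::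
  "('x, 'm, 'p, 'o, 'a) sixff \<Rightarrow> ('m, 'o, 'a) assignment \<Rightarrow> bool" where
  "base_change_compatible F \<Lambda> \<longleftrightarrow> (\<forall>i j i' j' g gZ.
     recollement F i j \<and> recollement F i' j' \<and> cartesian_square (Sp F) i gZ g i' \<and>
     bc_isos F i gZ g i' \<longrightarrow>
     (\<forall>A \<in> Obj (Cat F (tgt F i)). \<forall>d. \<forall>c \<in> supported F j A d.
        pull F g A d c \<in> supported F j' (upO F g A) d \<longrightarrow>
        \<Lambda> i' (upO F g A) d (pull F g A d c) = loc_pull F i gZ g i' A d (\<Lambda> i A d c)))"

definition pushforward_compatible ::
  "('x, 'm, 'p, 'o, 'a) sixff \<Rightarrow> ('m, 'o, 'a) assignment \<Rightarrow> bool" where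
  "pushforward_compatible F \<Lambda> \<longleftrightarrow> (\<forall>i j k l p pZ.
     recollement F i j \<and> recollement F k l \<and> p \<in> Proper (Sp F) \<and>
     cartesian_square (Sp F) p i k pZ \<and> bc_proper_isos F p i k pZ \<longrightarrow>
     (\<forall>\<epsilon> \<in> pft F p. \<forall>A \<in> Obj (Cat F (tgt F p)). \<forall>d. \<forall>c \<in> supported F j (upO F p A) d.
        push F p \<epsilon> A d c \<in> supported F l A d \<longrightarrow>
        \<Lambda> k A d (push F p \<epsilon> A d c) = loc_push F p i k pZ \<epsilon> A d (\<Lambda> i (upO F p A) d c)))"

definition external_product_compatible ::
  "('x, 'm, 'p, 'o, 'a) sixff \<Rightarrow> ('m, 'o, 'a) assignment \<Rightarrow> bool" where
  "external_product_compatible F \<Lambda> \<longleftrightarrow> (\<forall>i j iY jY a b a' b' Y.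
     recollement F i j \<and> recollement F iY jY \<and>
     product_cone (Sp F) a b (tgt F i) Y \<and> product_cone (Sp F) a' b' (src F i) Y \<and>
     iY \<in> Hom (Sp F) (src F a') (src F a) \<and>
     a \<cdot>\<^bsub>Sp F\<^esub> iY = i \<cdot>\<^bsub>Sp F\<^esub> a' \<and> b \<cdot>\<^bsub>Sp F\<^esub> iY = b' \<and> ext_isos F i iY a b a' b' \<longrightarrow>
     (\<forall>A \<in> Obj (Cat F (tgt F i)). \<forall>B \<in> Obj (Cat F Y). \<forall>d e.
        \<forall>c \<in> supported F j A d. \<forall>\<beta> \<in> coh F Y B e.
        ext_class F a b A B d e c \<beta> \<in> supported F jY (ext_ob F a b A B) (d + e) \<longrightarrow>
        \<Lambda> iY (ext_ob F a b A B) (d + e) (ext_class F a b A B d e c \<beta>) =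
          loc_ext_class F i iY a b a' b' A B d e (\<Lambda> i A d c) \<beta>))"

definition excisive ::
  "('x, 'm, 'p, 'o, 'a) sixff \<Rightarrow> ('m, 'o, 'a) assignment \<Rightarrow> bool" where
  "excisive F \<Lambda> \<longleftrightarrow> (\<forall>i j v iV jV.
     recollement F i j \<and> recollement F iV jV \<and> v \<in> OpenImm (Sp F) \<and>
     tgt F v = tgt F i \<and> iV \<in> Hom (Sp F) (src F i) (src F v) \<and> v \<cdot>\<^bsub>Sp F\<^esub> iV = i \<and>
     bc_isos F i (Ident (Sp F) (src F i)) v iV \<longrightarrow>
     (\<forall>A \<in> Obj (Cat F (tgt F i)). \<forall>d. \<forall>c \<in> supported F j A d.
        pull F v A d c \<in> supported F jV (upO F v A) d \<longrightarrow>
        exA F iV (upS F v d A) \<cdot>\<^bsub>Cat F (src F i)\<^esub>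
          excision_map F i v iV (shO (Cat F (tgt F i)) d A) \<cdot>\<^bsub>Cat F (src F i)\<^esub> \<Lambda> i A d c =
        \<Lambda> iV (upO F v A) d (pull F v A d c)))"

end

theory Submission
  imports Defs
begin

text \<open>Triangle compatibility says that the adjoint of \<open>\<Lambda>\<^sub>Z(c)\<close> is a lift of \<open>c\<close>,
  and \<open>\<Lambda>\<^sub>Z(c)\<close> is recovered from its adjoint by the adjunction bijection. The substance is thus that
  \<^const>\<open>adj_inv\<close> is a right inverse of \<^const>\<open>adj\<close>, which is a triangle identity of
  \<open>i\<^sup>* \<stileturn> i\<^sub>*\<close>.\<close>

lemma (in category) inverse_arrows_unique:
  assumes "inverse_arrows C f g" "inverse_arrows C f h"
  shows "g = h"
proof -
  have f: "f \<in> Hom C (Src C f) (Tgt C f)" and g: "g \<in> Hom C (Tgt C f) (Src C f)"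
    and h: "h \<in> Hom C (Tgt C f) (Src C f)"
    using assms by (auto simp: inverse_arrows_def Hom_def)
  have "g = g \<cdot> (f \<cdot> h)"
    using Comp_Ident[OF g] assms(2) by (simp add: inverse_arrows_def)
  also have "\<dots> = (g \<cdot> f) \<cdot> h"
    by (rule Comp_assoc[OF h f g, symmetric])
  also have "\<dots> = h"
    using Ident_Comp[OF h] assms(1) by (simp add: inverse_arrows_def)
  finally show ?thesis .
qed

text \<open>\<open>invar\<close> is a definite description, so it denotes an inverse only once
  uniqueness is known; existence is \<open>iso_arr\<close>.\<close>

lemma (in category) inverse_arrows_invar:
  assumes "iso_arr C f"
  shows "inverse_arrows C f (invar C f)"
  using assms inverse_arrows_unique theI[of "inverse_arrows C f"]
  unfolding iso_arr_def invar_def by metis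

lemma is_functor_Hom:
  assumes "is_functor C D F" "f \<in> Hom C A B"
  shows "fA F f \<in> Hom D (fO F A) (fO F B)"
  using assms by (auto simp: is_functor_def Hom_def)

lemma is_functor_Comp:
  assumes "is_functor C D F" "f \<in> Hom C A B" "g \<in> Hom C B E"
  shows "fA F (g \<cdot>\<^bsub>C\<^esub> f) = fA F g \<cdot>\<^bsub>D\<^esub> fA F f"
  using assms by (auto simp: is_functor_def Hom_def)

lemma adjunction_unit_Hom:
  assumes "adjunction C D L R \<eta> \<epsilon>" "A \<in> Obj C"
  shows "\<eta> A \<in> Hom C A (fO R (fO L A))"
  using assms by (simp add: adjunction_def nat_trans_def id_fctr_def comp_fctr_def)

lemma adjunction_counit_Hom:
  assumes "adjunction C D L R \<eta> \<epsilon>" "B \<in> Obj D"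
  shows "\<epsilon> B \<in> Hom D (fO L (fO R B)) B"
  using assms by (simp add: adjunction_def nat_trans_def id_fctr_def comp_fctr_def)

lemma adjunction_counit_natural:
  assumes "adjunction C D L R \<eta> \<epsilon>" "f \<in> Hom D B B'"
  shows "\<epsilon> B' \<cdot>\<^bsub>D\<^esub> fA L (fA R f) = f \<cdot>\<^bsub>D\<^esub> \<epsilon> B"
  using assms by (auto simp: adjunction_def nat_trans_def id_fctr_def comp_fctr_def Hom_def)

text \<open>Naturality of the counit moves \<open>f\<close> to the front, and the triangle identity
  at \<open>A\<close> collapses the remaining factor. This is the half of the hom-set bijection in
  which a morphism out of \<open>fO L A\<close> survives transposition to \<open>C\<close> and
  back.\<close>

lemma adjunction_transpose:
  assumes D: "category D" and L: "is_functor C D L" and R: "is_functor D C R"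
    and adj: "adjunction C D L R \<eta> \<epsilon>"
    and A: "A \<in> Obj C" and f: "f \<in> Hom D (fO L A) B"
  shows "\<epsilon> B \<cdot>\<^bsub>D\<^esub> fA L (fA R f \<cdot>\<^bsub>C\<^esub> \<eta> A) = f"
proof -
  interpret D: category D by (rule D)
  have LA: "fO L A \<in> Obj D" and B: "B \<in> Obj D"
    using f D.Src_Obj[of f] D.Tgt_Obj[of f] by (auto simp: Hom_def)
  have \<eta>: "\<eta> A \<in> Hom C A (fO R (fO L A))"
    by (rule adjunction_unit_Hom[OF adj A])
  have Rf: "fA R f \<in> Hom C (fO R (fO L A)) (fO R B)"
    by (rule is_functor_Hom[OF R f])
  have "\<epsilon> B \<cdot>\<^bsub>D\<^esub> fA L (fA R f \<cdot>\<^bsub>C\<^esub> \<eta> A) = \<epsilon> B \<cdot>\<^bsub>D\<^esub> (fA L (fA R f) \<cdot>\<^bsub>D\<^esub> fA L (\<eta> A))"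
    by (simp only: is_functor_Comp[OF L \<eta> Rf])
  also have "\<dots> = (\<epsilon> B \<cdot>\<^bsub>D\<^esub> fA L (fA R f)) \<cdot>\<^bsub>D\<^esub> fA L (\<eta> A)"
    by (rule D.Comp_assoc[OF is_functor_Hom[OF L \<eta>] is_functor_Hom[OF L Rf]
          adjunction_counit_Hom[OF adj B], symmetric])
  also have "\<dots> = (f \<cdot>\<^bsub>D\<^esub> \<epsilon> (fO L A)) \<cdot>\<^bsub>D\<^esub> fA L (\<eta> A)"
    by (simp only: adjunction_counit_natural[OF adj f])
  also have "\<dots> = f \<cdot>\<^bsub>D\<^esub> (\<epsilon> (fO L A) \<cdot>\<^bsub>D\<^esub> fA L (\<eta> A))"
    by (rule D.Comp_assoc[OF is_functor_Hom[OF L \<eta>] adjunction_counit_Hom[OF adj LA] f])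
  also have "\<dots> = f \<cdot>\<^bsub>D\<^esub> Ident D (fO L A)"
    using adj A by (simp add: adjunction_def)
  also have "\<dots> = f"
    by (rule D.Comp_Ident[OF f])
  finally show ?thesis .
qed

context six_functor_formalism
begin

lemma Cat_category: "X \<in> Obj (Sp F) \<Longrightarrow> category (Cat F X)"
  using Cat_tt tt_category.axioms(1) triangulated_category.axioms(1) additive_category.axioms(1)
  by blast

text \<open>\<open>adj_inv\<close> strips the identification \<open>mon1 F i\<close> of the two
  units and transposes; \<open>adj\<close> transposes back and restores \<open>mon1 F i\<close>.
  Both pairs of operations cancel.\<close>

lemma
  assumes i: "i \<in> Hom (Sp F) Z X"
    and \<mu>: "\<mu> \<in> Hom (Cat F Z) (tI (Cat F Z)) N"
  shows adj_inv_Hom: "adj_inv F i \<mu> \<in> Hom (Cat F X) (tI (Cat F X)) (loO F i N)"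
    and adj_adj_inv: "adj F i N (adj_inv F i \<mu>) = \<mu>"
proof -
  interpret S: category_of_spaces "Sp F" by (rule spaces)
  have src [simp]: "src F i = Z" and tgt [simp]: "tgt F i = X"
    and Z: "Z \<in> Obj (Sp F)" and X: "X \<in> Obj (Sp F)"
    using i S.Src_Obj[of i] S.Tgt_Obj[of i] by (auto simp: Hom_def)
  interpret CZ: category "Cat F Z" by (rule Cat_category[OF Z])
  interpret CX: category "Cat F X" by (rule Cat_category[OF X])
  let ?m = "mon1 F i" and ?m' = "invar (Cat F Z) (mon1 F i)"
  \<comment> \<open>\<open>\<mu>\<close> starts at the unit of \<open>Cat F Z\<close>. Precomposing
    with \<open>?m'\<close> makes it start at the pullback of the unit of \<open>Cat F X\<close>,
    the form of source that transposition along \<open>i\<close> requires.\<close>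
  let ?f = "\<mu> \<cdot>\<^bsub>Cat F Z\<^esub> ?m'"
  have up: "is_functor (Cat F X) (Cat F Z) (ups F i)"
    and lo: "is_functor (Cat F Z) (Cat F X) (los F i)"
    using ups_exact[OF i] los_exact[OF i] by (simp_all add: exact_functor_def)
  have one: "tI (Cat F X) \<in> Obj (Cat F X)"
    by (rule tt_category.One_Obj[OF Cat_tt[OF X]])
  have m: "?m \<in> Hom (Cat F Z) (tI (Cat F Z)) (upO F i (tI (Cat F X)))"
    and m_iso: "iso_arr (Cat F Z) ?m"
    using symmetric_monoidal_pullback.mon1_Hom[OF ups_monoidal[OF i]] by auto
  have m': "?m' \<in> Hom (Cat F Z) (upO F i (tI (Cat F X))) (tI (Cat F Z))"
    and m'm: "?m' \<cdot>\<^bsub>Cat F Z\<^esub> ?m = Ident (Cat F Z) (tI (Cat F Z))"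
    using CZ.inverse_arrows_invar[OF m_iso] m by (auto simp: inverse_arrows_def Hom_def)
  have f: "?f \<in> Hom (Cat F Z) (upO F i (tI (Cat F X))) N"
    by (rule CZ.Comp_Hom[OF m' \<mu>])
  have N: "N \<in> Obj (Cat F Z)"
    using \<mu> CZ.Tgt_Obj by (auto simp: Hom_def)
  show inv: "adj_inv F i \<mu> \<in> Hom (Cat F X) (tI (Cat F X)) (loO F i N)"
    unfolding adj_inv_def src tgt
    by (rule CX.Comp_Hom[OF adjunction_unit_Hom[OF ups_los[OF i] one] is_functor_Hom[OF lo f]])
  \<comment> \<open>Composition associates to the right, so the factors are regrouped: the bracket
    becomes the left side of \<open>adjunction_transpose\<close> for \<open>?f\<close> once
    \<open>adj_inv\<close> is unfolded.\<close>
  have "adj F i N (adj_inv F i \<mu>) =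
      (aco F i N \<cdot>\<^bsub>Cat F Z\<^esub> upA F i (adj_inv F i \<mu>)) \<cdot>\<^bsub>Cat F Z\<^esub> ?m"
    unfolding adj_def src
    by (rule CZ.Comp_assoc[OF m is_functor_Hom[OF up inv]
          adjunction_counit_Hom[OF ups_los[OF i] N], symmetric])
  also have "\<dots> = ?f \<cdot>\<^bsub>Cat F Z\<^esub> ?m"
    unfolding adj_inv_def src tgt
    by (simp only: adjunction_transpose[OF CZ.category_axioms up lo ups_los[OF i] one f])
  also have "\<dots> = \<mu> \<cdot>\<^bsub>Cat F Z\<^esub> (?m' \<cdot>\<^bsub>Cat F Z\<^esub> ?m)"
    by (rule CZ.Comp_assoc[OF m m' \<mu>])
  also have "\<dots> = \<mu>"
    using CZ.Comp_Ident[OF \<mu>] m'm by simp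
  finally show "adj F i N (adj_inv F i \<mu>) = \<mu>" .
qed

text \<open>The lift witnessing membership is \<open>adj_inv F i \<mu>\<close>. It maps to
  \<open>c\<close> by assumption, and \<open>adj\<close> sends it back to
  \<open>\<mu>\<close>.\<close>

lemma Loc_torI:
  assumes "i \<in> Arr (Sp F)" "\<mu> \<in> loc_grp F i A d" "forg F i A d (adj_inv F i \<mu>) = c"
  shows "\<mu> \<in> Loc_tor F i A d c"
proof -
  have i: "i \<in> Hom (Sp F) (src F i) (tgt F i)"
    using assms(1) by (simp add: Hom_def)
  note \<mu> = assms(2)[unfolded loc_grp_def]
  have "adj_inv F i \<mu> \<in> Lift F i A d c"
    using adj_inv_Hom[OF i \<mu>] assms(3) by (simp add: Lift_def coh_supp_def)
  then show ?thesis
    unfolding Loc_tor_def using adj_adj_inv[OF i \<mu>, symmetric] by (rule rev_image_eqI)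
qed

end

theorem proposition4p19:
  fixes F :: "('x, 'm, 'p, 'o, 'a) sixff"
    and i j :: 'm
    and \<Lambda> :: "('m, 'o, 'a) assignment"
  assumes "six_functor_formalism F"
    and "recollement F i j"
    and "localizes F \<Lambda>"
    and a: "triangle_compatible F i j \<Lambda>"
    and b: "base_change_compatible F \<Lambda>" "pushforward_compatible F \<Lambda>"
      "external_product_compatible F \<Lambda>"
    and c: "excisive F \<Lambda>"
  shows "\<forall>A \<in> Obj (Cat F (tgt F i)). \<forall>d. \<forall>c \<in> supported F j A d.
     \<Lambda> i A d c \<in> Loc_tor F i A d c \<and>
     (is_singleton (Loc_tor F i A d c) \<longrightarrow> \<Lambda> i A d c = Loc F i A d c)"
proof (intro ballI allI)
  fix A d c
  assume A: "A \<in> Obj (Cat F (tgt F i))" and supp: "c \<in> supported F j A d"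
  interpret six_functor_formalism F by (rule assms(1))
  have "i \<in> Arr (Sp F)"
    using assms(2) category_of_spaces.ClosedImm[OF spaces]
    by (auto simp: recollement_def open_complement_def)
  moreover have "\<Lambda> i A d c \<in> loc_grp F i A d"
    using assms(2,3) A supp by (auto simp: localizes_def)
  \<comment> \<open>Unfolding \<open>forg\<close> turns this into the counit composite that triangle
    compatibility equates with \<open>c\<close>.\<close>
  moreover have "forg F i A d (adj_inv F i (\<Lambda> i A d c)) = c"
    using a A supp by (simp add: triangle_compatible_def forg_def)
  ultimately have mem: "\<Lambda> i A d c \<in> Loc_tor F i A d c"
    by (rule Loc_torI)
  \<comment> \<open>\<open>Loc\<close> is \<open>the_elem\<close> of the set, so on a singleton it
    agrees with the member just found.\<close>
  moreover have "\<Lambda> i A d c = Loc F i A d c" if "is_singleton (Loc_tor F i A d c)"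
    using that mem by (auto simp: is_singleton_def Loc_def)
  ultimately show "\<Lambda> i A d c \<in> Loc_tor F i A d c \<and>
     (is_singleton (Loc_tor F i A d c) \<longrightarrow> \<Lambda> i A d c = Loc F i A d c)"
    by blast
qed

end
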